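(* Let $\{z^t\}$ be the sequence of SQG-estimates at a point $x\in X$. Assume that (i) for all $t$ the tracked densities $g^t$ belong to $G$ and $|g^{t+1}(x)-g^t(x)|\le\delta_t\to0$; (ii) the kernel $K$ is a bounded Borel density with $\int_X K(y)\,dy=1$, $\sup_{y\in X} K(y)\le\overline K$, and $\int_{\mathbb{R}^r}\|y\|^{\nu}K(y)\,dy<+\infty$; (iii) the adjustment coefficients $\rho_t>0$ and window parameters $\theta_t>0$ are deterministic and satisfy $$\lim_{t\to\infty}\rho_t=\lim_{t\to\infty}\theta_t=0,\qquad \lim_{t\to\infty}\frac{\delta_t}{\rho_t}=\lim_{t\to\infty}\frac{\rho_t}{\theta_t^r}=0,\qquad \sum_{t=0}^{\infty}\rho_t=+\infty.$$ Then at any point $x$ where all densities $g^t$ are globally Hölder continuous (with constants $H=H(x)$, $\nu=\nu(x)>0$), $$\lim_{t\to\infty}\mathbf{E}(z^t-g^t(x))^2=0.$$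
   Context: Let $X\subseteq\mathbb{R}^r$. $G$ is the class of functions $g$ on $X$ with $0\le\underline g(x)\le g(x)\le\overline g(x)\le\overline g$ for all $x\in X$, where $\underline g(\cdot),\overline g(\cdot)$ are given functions and $\overline g$ is a finite constant. For $t=0,1,\dots$, $g^t$ is a probability density on $X$; the observations $\overline x_0,\overline x_1,\dots$ are independent random vectors on a probability space $(\Omega,\Sigma,P)$, $\overline x_t$ having density $g^t$. $K\ge0$ is a kernel. Global Hölder continuity at $x$: there are $H=H(x)$ and $\nu=\nu(x)>0$, not depending on $t$, such that $|g^t(x)-g^t(y)|\le H\|x-y\|^{\nu}$ for all $y\in X$ and all $t$. SQG-estimates at $x$: given $z^0\in[\underline g(x),\overline g(x)]$, adjustment coefficients $\rho_t$ and window parameters $\theta_t$, $$z^{t+1}=\min\{\overline g(x),\max\{\underline g(x),\,z^t-\rho_t\xi_t\}\},\qquad \xi_t=z^t-\frac1{\theta_t^r}K\Big(\frac{\overline x_t-x}{\theta_t}\Big),\quad t=0,1,\dots$$ $\mathbf{E}$ denotes expectation.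
   Formalization: Adds the assumption that the integral over X of θ_t^{-r} K((y−x)/θ_t) tends to 1 (automatic if x is interior to X); without it the claim fails, e.g. X=[0,1], x=1, K=1 on [0,1], g^t=1, z^0=0. X is taken Borel and K a bounded density on all of R^r. *)

theory Defs
  imports "HOL-Probability.Probability"
begin

definition class_G ::
    "'a set \<Rightarrow> ('a \<Rightarrow> real) \<Rightarrow> ('a \<Rightarrow> real) \<Rightarrow> real \<Rightarrow> ('a \<Rightarrow> real) set" where
  "class_G X lo hi gmax =
     {g. \<forall>x\<in>X. 0 \<le> lo x \<and> lo x \<le> g x \<and> g x \<le> hi x \<and> hi x \<le> gmax}"

definition density_on :: "'a::euclidean_space set \<Rightarrow> ('a \<Rightarrow> real) \<Rightarrow> bool" where
  "density_on X g \<longleftrightarrow>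
     set_borel_measurable borel X g \<and> (\<forall>y\<in>X. 0 \<le> g y) \<and> (LINT y:X|lborel. g y) = 1"

definition globally_Hoelder_at ::
    "'a::real_normed_vector set \<Rightarrow> (nat \<Rightarrow> 'a \<Rightarrow> real) \<Rightarrow> 'a \<Rightarrow> real \<Rightarrow> real \<Rightarrow> bool" where
  "globally_Hoelder_at X g x H \<nu> \<longleftrightarrow>
     \<nu> > 0 \<and> (\<forall>t. \<forall>y\<in>X. \<bar>g t x - g t y\<bar> \<le> H * norm (x - y) powr \<nu>)"

definition scaled_kernel ::
    "(real^'r \<Rightarrow> real) \<Rightarrow> real \<Rightarrow> real^'r \<Rightarrow> real^'r \<Rightarrow> real" where
  "scaled_kernel K \<theta> x y = 1 / \<theta> ^ CARD('r) * K ((1 / \<theta>) *\<^sub>R (y - x))"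

definition sqg_direction ::
    "(real^'r \<Rightarrow> real) \<Rightarrow> real \<Rightarrow> real^'r \<Rightarrow> real^'r \<Rightarrow> real \<Rightarrow> real" where
  "sqg_direction K \<theta> x y z = z - scaled_kernel K \<theta> x y"

primrec sqg_estimate ::
    "(real^'r \<Rightarrow> real) \<Rightarrow> (real^'r \<Rightarrow> real) \<Rightarrow> (real^'r \<Rightarrow> real) \<Rightarrow> (nat \<Rightarrow> real) \<Rightarrow> (nat \<Rightarrow> real)
      \<Rightarrow> real \<Rightarrow> (nat \<Rightarrow> 'w \<Rightarrow> real^'r) \<Rightarrow> real^'r \<Rightarrow> nat \<Rightarrow> 'w \<Rightarrow> real" where
  "sqg_estimate lo hi K \<rho> \<theta> z0 obs x 0 \<omega> = z0"
| "sqg_estimate lo hi K \<rho> \<theta> z0 obs x (Suc t) \<omega> =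
     min (hi x) (max (lo x)
       (sqg_estimate lo hi K \<rho> \<theta> z0 obs x t \<omega>
         - \<rho> t * sqg_direction K (\<theta> t) x (obs t \<omega>) (sqg_estimate lo hi K \<rho> \<theta> z0 obs x t \<omega>)))"

definition bounded_Borel_density :: "(real^'r \<Rightarrow> real) \<Rightarrow> bool" where
  "bounded_Borel_density K \<longleftrightarrow>
     K \<in> borel_measurable borel \<and> (\<forall>y. 0 \<le> K y) \<and> bounded (range K)
     \<and> (LINT y|lborel. K y) = 1"

text \<open>The windows at \<open>x\<close> asymptotically lose no kernel mass outside \<open>X\<close>. Without this, the kernel
  averages of the observations at a boundary point of \<open>X\<close> are biased: for \<open>X = {0..1}\<close>, \<open>x = 1\<close>,
  \<open>K\<close> the indicator of \<open>{0..1}\<close> and uniform observations, every scaled kernel value is almost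
  surely \<open>0\<close>. The condition holds whenever \<open>x\<close> is interior to \<open>X\<close>
  (\<open>window_mass_in_interior\<close> below), in particular at every \<open>x\<close> if \<open>X = UNIV\<close>.\<close>

definition window_mass_in ::
    "(real^'r) set \<Rightarrow> (real^'r \<Rightarrow> real) \<Rightarrow> (nat \<Rightarrow> real) \<Rightarrow> real^'r \<Rightarrow> bool" where
  "window_mass_in X K \<theta> x \<longleftrightarrow>
     (\<lambda>t. LINT y:X|lborel. scaled_kernel K (\<theta> t) x y) \<longlonglongrightarrow> 1"

lemma window_integral_eq:
  fixes K :: "real^'r \<Rightarrow> real"
  assumes K: "K \<in> borel_measurable borel" and X: "X \<in> sets borel" and th: "\<theta> > 0"
  shows "(LINT y:X|lborel. scaled_kernel K \<theta> x y)
    = (LINT u|lborel. indicator X (x + \<theta> *\<^sub>R u) * K u)"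
proof -
  have m [measurable]: "K \<in> borel_measurable borel" "X \<in> sets borel" by fact+
  have "(LINT y:X|lborel. scaled_kernel K \<theta> x y)
    = (LINT y|density (distr lborel borel (\<lambda>u. x + \<theta> *\<^sub>R u)) (\<lambda>_. \<bar>\<theta>\<bar> ^ DIM(real^'r)).
         indicator X y * scaled_kernel K \<theta> x y)"
    using lborel_affine[of \<theta> x] th by (simp add: set_lebesgue_integral_def)
  also have "\<dots> = (LINT y|distr lborel borel (\<lambda>u. x + \<theta> *\<^sub>R u).
         \<theta> ^ CARD('r) * (indicator X y * scaled_kernel K \<theta> x y))"
    using th by (subst integral_density) (auto simp: scaled_kernel_def)
  also have "\<dots> = (LINT u|lborel. \<theta> ^ CARD('r) *
       (indicator X (x + \<theta> *\<^sub>R u) * scaled_kernel K \<theta> x (x + \<theta> *\<^sub>R u)))"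
    by (subst integral_distr) (auto simp: scaled_kernel_def)
  also have "\<dots> = (LINT u|lborel. indicator X (x + \<theta> *\<^sub>R u) * K u)"
    using th by (simp add: scaled_kernel_def)
  finally show ?thesis .
qed

lemma window_mass_in_interior:
  fixes K :: "real^'r \<Rightarrow> real"
  assumes K: "bounded_Borel_density K" and X: "X \<in> sets borel" and x: "x \<in> interior X"
    and pos: "\<And>t. \<theta> t > 0" and lim: "\<theta> \<longlonglongrightarrow> 0"
  shows "window_mass_in X K \<theta> x"
proof -
  have m [measurable]: "K \<in> borel_measurable borel" "X \<in> sets borel"
    and K0: "\<And>y. 0 \<le> K y" and K1: "(LINT y|lborel. K y) = 1"
    using K X by (auto simp: bounded_Borel_density_def)
  have "(\<lambda>t. LINT u|lborel. indicator X (x + \<theta> t *\<^sub>R u) * K u) \<longlonglongrightarrow> (LINT u|lborel. K u)"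
  proof (rule integral_dominated_convergence[where w = K])
    show "integrable lborel K"
      using K1 not_integrable_integral_eq[of lborel K] by fastforce
    show "AE u in lborel. (\<lambda>t. indicator X (x + \<theta> t *\<^sub>R u) * K u) \<longlonglongrightarrow> K u"
    proof (rule AE_I2)
      fix u
      have "(\<lambda>t. x + \<theta> t *\<^sub>R u) \<longlonglongrightarrow> x + 0 *\<^sub>R u"
        by (intro tendsto_intros lim)
      then have "\<forall>\<^sub>F t in sequentially. x + \<theta> t *\<^sub>R u \<in> interior X"
        using topological_tendstoD[OF _ open_interior] x by fastforce
      then have "\<forall>\<^sub>F t in sequentially. indicator X (x + \<theta> t *\<^sub>R u) * K u = K u"
        by eventually_elim (use interior_subset in \<open>auto simp: indicator_def\<close>)
      then show "(\<lambda>t. indicator X (x + \<theta> t *\<^sub>R u) * K u) \<longlonglongrightarrow> K u"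
        by (rule tendsto_eventually)
    qed
  qed (auto simp: K0 indicator_def)
  then show ?thesis
    unfolding window_mass_in_def using K1 window_integral_eq[OF m pos] by simp
qed

end

theory Submission
  imports Defs
begin

text \<open>Clipping to an interval containing \<open>g\<^sup>t(x)\<close> does not increase the distance to \<open>g\<^sup>t(x)\<close>, so one may
  expand the square of the unclipped step. Since \<open>z\<^sup>t\<close> depends only on the earlier observations, the
  mixed term has expectation of the order of the bias of the kernel value, which tends to \<open>0\<close> by
  Hoelder continuity; the second moment of the kernel value is of order \<open>1 / \<theta>\<^sub>t\<^sup>r\<close>. Hence
  \<open>V\<^sub>t = E(z\<^sup>t - g\<^sup>t(x))\<^sup>2\<close> satisfies \<open>V\<^sub>t\<^sub>+\<^sub>1 \<le> (1 - \<rho>\<^sub>t) V\<^sub>t + \<rho>\<^sub>t \<epsilon>\<^sub>t\<close> with \<open>\<epsilon>\<^sub>t\<close> composed of the bias,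
  \<open>\<rho>\<^sub>t / \<theta>\<^sub>t\<^sup>r\<close>, \<open>\<rho>\<^sub>t\<close> and \<open>\<delta>\<^sub>t / \<rho>\<^sub>t\<close>; as \<open>\<epsilon>\<^sub>t\<close> vanishes and the \<open>\<rho>\<^sub>t\<close> are not summable, \<open>V\<^sub>t\<close> vanishes.\<close>

section \<open>Decay of a scalar averaging recursion\<close>

text \<open>Once \<open>\<epsilon> t < e\<close> for a fixed \<open>e > 0\<close>, the excess
  satisfies \<open>V (Suc t) - e \<le> (1 - \<rho> t) * (V t - e)\<close>, and
  \<open>1 - \<rho> t \<le> exp (- \<rho> t)\<close>. The product of these factors is the
  exponential of minus a partial sum of \<open>\<rho>\<close>, which divergence of the series sends
  to 0.\<close>

lemma averaging_recursion_tendsto_0: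
  fixes V \<rho> \<epsilon> :: "nat \<Rightarrow> real"
  assumes nonneg: "\<And>t. 0 \<le> V t" and pos: "\<And>t. 0 \<le> \<rho> t"
    and step: "\<forall>\<^sub>F t in sequentially. \<rho> t \<le> 1 \<and> V (Suc t) \<le> (1 - \<rho> t) * V t + \<rho> t * \<epsilon> t"
    and eps: "\<epsilon> \<longlonglongrightarrow> 0"
    and div: "filterlim (\<lambda>n. \<Sum>t<n. \<rho> t) at_top sequentially"
  shows "V \<longlonglongrightarrow> 0"
proof (rule LIMSEQ_I)
  fix r :: real assume r: "0 < r"
  \<comment> \<open>One half of \<open>r\<close> is the level below which \<open>\<epsilon>\<close>
    falls, the other half bounds the decaying excess.\<close>
  define e where "e = r / 2"
  have e: "e > 0" using r by (simp add: e_def)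
  have "\<forall>\<^sub>F t in sequentially. \<epsilon> t < e" by (rule order_tendstoD(2)[OF eps e])
  with step have "\<forall>\<^sub>F t in sequentially. \<rho> t \<le> 1 \<and> V (Suc t) \<le> (1 - \<rho> t) * V t + \<rho> t * e"
    by eventually_elim (use pos in \<open>smt (verit) mult_left_mono\<close>)
  then obtain N where N: "\<And>t. t \<ge> N \<Longrightarrow> \<rho> t \<le> 1"
    "\<And>t. t \<ge> N \<Longrightarrow> V (Suc t) \<le> (1 - \<rho> t) * V t + \<rho> t * e"
    unfolding eventually_sequentially by blast
  define S where "S n = (\<Sum>t<n. \<rho> t)" for n
  \<comment> \<open>The absolute value keeps the right side nonnegative even if
    \<open>V N < e\<close>; this is what permits replacing \<open>1 - \<rho> n\<close> by the larger
    \<open>exp (- \<rho> n)\<close>.\<close>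
  have bound: "V n - e \<le> exp (S N - S n) * \<bar>V N - e\<bar>" if "n \<ge> N" for n
    using that
  proof (induction n rule: dec_induct)
    case (step n)
    have "V (Suc n) - e \<le> (1 - \<rho> n) * (V n - e)"
      using N(2)[OF step(1)] by (simp add: algebra_simps)
    also have "\<dots> \<le> (1 - \<rho> n) * (exp (S N - S n) * \<bar>V N - e\<bar>)"
      using N(1)[OF step(1)] step.IH by (intro mult_left_mono) auto
    also have "\<dots> \<le> exp (- \<rho> n) * (exp (S N - S n) * \<bar>V N - e\<bar>)"
      using exp_ge_add_one_self[of "- \<rho> n"] by (intro mult_right_mono) auto
    also have "\<dots> = exp (S N - S (Suc n)) * \<bar>V N - e\<bar>"
      by (simp add: S_def flip: mult.assoc exp_add)
    finally show ?case .
  qed simp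
  have "filterlim (\<lambda>n. - S N + S n) at_top sequentially"
    unfolding S_def by (rule filterlim_tendsto_add_at_top[OF tendsto_const div])
  then have "filterlim (\<lambda>n. S N - S n) at_bot sequentially"
    by (simp add: filterlim_uminus_at_top)
  then have "(\<lambda>n. exp (S N - S n)) \<longlonglongrightarrow> 0"
    by (rule filterlim_compose[OF exp_at_bot])
  then have "(\<lambda>n. exp (S N - S n) * \<bar>V N - e\<bar>) \<longlonglongrightarrow> 0"
    by (rule tendsto_mult_left_zero)
  then have "\<forall>\<^sub>F n in sequentially. exp (S N - S n) * \<bar>V N - e\<bar> < e"
    using e by (rule order_tendstoD(2))
  with eventually_ge_at_top[of N] have "\<forall>\<^sub>F n in sequentially. norm (V n - 0) < r"
  proof eventually_elim
    case (elim n)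
    then show ?case using bound[of n] nonneg[of n] by (simp add: e_def)
  qed
  then show "\<exists>no. \<forall>n\<ge>no. norm (V n - 0) < r"
    unfolding eventually_sequentially .
qed

section \<open>Range, measurability and independence of the estimates\<close>

lemma sqg_estimate_between:
  assumes "lo x \<le> z0" "z0 \<le> hi x"
  shows "lo x \<le> sqg_estimate lo hi K \<rho> \<theta> z0 obs x t \<omega>"
    and "sqg_estimate lo hi K \<rho> \<theta> z0 obs x t \<omega> \<le> hi x"
  using assms by (cases t; auto)+

text \<open>Running the recursion on the coordinate projections \<open>\<lambda>s f. f s\<close>
  turns the estimate into a fixed function on a product space, so that measurability and
  independence can be read off from the index sets.\<close>

lemma sqg_estimate_restrict:
  assumes "t \<le> n"
  shows "sqg_estimate lo hi K \<rho> \<theta> z0 obs x t \<omega>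
    = sqg_estimate lo hi K \<rho> \<theta> z0 (\<lambda>s f. f s) x t (restrict (\<lambda>i. obs i \<omega>) {..<n})"
  using assms by (induction t) auto

lemma scaled_kernel_measurable:
  assumes [measurable]: "K \<in> borel_measurable borel"
  shows "scaled_kernel K \<theta> x \<in> borel_measurable borel"
  unfolding scaled_kernel_def by measurable

text \<open>Keeping \<open>n\<close> apart from \<open>t\<close> fixes the product space during the
  induction; the step to \<open>Suc t\<close> reads coordinate \<open>t\<close>, which lies in
  \<open>{..<n}\<close> because \<open>Suc t \<le> n\<close>.\<close>

lemma sqg_estimate_measurable:
  assumes [measurable]: "K \<in> borel_measurable borel" and "t \<le> n"
  shows "sqg_estimate lo hi K \<rho> \<theta> z0 (\<lambda>s f. f s) x t \<in> borel_measurable (PiM {..<n} (\<lambda>_. borel))"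
  using \<open>t \<le> n\<close>
proof (induction t)
  case 0
  have "sqg_estimate lo hi K \<rho> \<theta> z0 (\<lambda>s f. f s) x 0 = (\<lambda>_. z0)" by (rule ext) simp
  then show ?case by simp
next
  case (Suc t)
  have [measurable]: "sqg_estimate lo hi K \<rho> \<theta> z0 (\<lambda>s f. f s) x t \<in> borel_measurable (PiM {..<n} (\<lambda>_. borel))"
    using Suc by simp
  have [measurable]: "(\<lambda>f. f t) \<in> borel_measurable (PiM {..<n} (\<lambda>_. borel :: (real^'a) measure))"
    using Suc by (intro measurable_component_singleton) auto
  show ?case
    unfolding sqg_estimate.simps sqg_direction_def scaled_kernel_def by measurable
qed

text \<open>The estimate at time \<open>t\<close> has used the observations with index below
  \<open>t\<close> only, so the two variables depend on the disjoint index sets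
  \<open>{..<t}\<close> and \<open>{t}\<close>.\<close>

lemma (in prob_space) indep_var_sqg_estimate_obs:
  fixes f :: "real^'r \<Rightarrow> real"
  assumes K: "K \<in> borel_measurable borel" and ind: "indep_vars (\<lambda>_. borel) obs UNIV"
    and f: "f \<in> borel_measurable borel"
  shows "indep_var borel (sqg_estimate lo hi K \<rho> \<theta> z0 obs x t) borel (\<lambda>\<omega>. f (obs t \<omega>))"
proof -
  let ?Z = "sqg_estimate lo hi K \<rho> \<theta> z0 (\<lambda>s f. f s) x t"
  have "indep_var borel (?Z \<circ> (\<lambda>\<omega>. restrict (\<lambda>i. obs i \<omega>) {..<t}))
     borel ((\<lambda>h. f (h t)) \<circ> (\<lambda>\<omega>. restrict (\<lambda>i. obs i \<omega>) {t}))"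
    by (intro indep_var_compose[OF indep_var_restrict[OF ind]] sqg_estimate_measurable K
        measurable_compose[OF _ f] measurable_component_singleton) auto
  then show ?thesis
    by (simp add: comp_def flip: sqg_estimate_restrict[of t t])
qed

section \<open>Integrals of rescaled kernels\<close>

text \<open>Under the substitution \<open>y = x + \<theta> u\<close> the Jacobian cancels the
  prefactor. A general \<open>F\<close> is allowed because both \<open>K\<close> and its moment
  integrand of order \<open>\<nu>\<close> get rescaled.\<close>

lemma affine_rescaling_lborel:
  fixes F :: "'a::euclidean_space \<Rightarrow> real"
  assumes F: "integrable lborel F" and th: "\<theta> > 0"
  shows "integrable lborel (\<lambda>y. 1 / \<theta> ^ DIM('a) * F ((1 / \<theta>) *\<^sub>R (y - x)))"
    and "(LINT y|lborel. 1 / \<theta> ^ DIM('a) * F ((1 / \<theta>) *\<^sub>R (y - x))) = (LINT u|lborel. F u)"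
proof -
  have [measurable]: "F \<in> borel_measurable borel" using F by auto
  have eq: "lborel = density (distr lborel borel (\<lambda>u. x + \<theta> *\<^sub>R u)) (\<lambda>_. \<bar>\<theta>\<bar> ^ DIM('a))"
    using lborel_affine[of \<theta> x] th by simp
  show "integrable lborel (\<lambda>y. 1 / \<theta> ^ DIM('a) * F ((1 / \<theta>) *\<^sub>R (y - x)))"
    using th F by (subst eq, subst integrable_density) (auto simp: integrable_distr_eq)
  show "(LINT y|lborel. 1 / \<theta> ^ DIM('a) * F ((1 / \<theta>) *\<^sub>R (y - x))) = (LINT u|lborel. F u)"
    using th by (subst eq, subst integral_density) (auto simp: integral_distr)
qed

lemma scaled_kernel_lborel:
  fixes K :: "real^'r \<Rightarrow> real"
  assumes K: "bounded_Borel_density K" and th: "\<theta> > 0"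
  shows "integrable lborel (scaled_kernel K \<theta> x)" and "integral\<^sup>L lborel (scaled_kernel K \<theta> x) = 1"
proof -
  \<comment> \<open>A non-integrable function has integral 0 by convention, so the value 1 forces
    integrability.\<close>
  have int: "integrable lborel K"
    using K not_integrable_integral_eq[of lborel K] by (fastforce simp: bounded_Borel_density_def)
  have eq: "scaled_kernel K \<theta> x = (\<lambda>y. 1 / \<theta> ^ DIM(real^'r) * K ((1 / \<theta>) *\<^sub>R (y - x)))"
    by (simp add: fun_eq_iff scaled_kernel_def)
  show "integrable lborel (scaled_kernel K \<theta> x)"
    unfolding eq by (rule affine_rescaling_lborel(1)[OF int th])
  show "integral\<^sup>L lborel (scaled_kernel K \<theta> x) = 1"
    unfolding eq affine_rescaling_lborel(2)[OF int th] using K by (simp add: bounded_Borel_density_def)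
qed

lemma scaled_kernel_nonneg:
  assumes "bounded_Borel_density K" and "\<theta> > 0"
  shows "0 \<le> scaled_kernel K \<theta> x y"
  using assms by (simp add: scaled_kernel_def bounded_Borel_density_def)

lemma scaled_kernel_le:
  fixes K :: "real^'r \<Rightarrow> real"
  assumes "\<And>y. K y \<le> B" and "\<theta> > 0"
  shows "scaled_kernel K \<theta> x y \<le> B / \<theta> ^ CARD('r)"
  using assms by (simp add: scaled_kernel_def divide_right_mono)

text \<open>Bounding one of the two kernel factors by its supremum leaves a kernel of mass 1; hence
  the order is \<open>1 / \<theta> ^ r\<close> and not its square.\<close>

lemma scaled_kernel_second_moment_le:
  fixes K :: "real^'r \<Rightarrow> real"
  assumes K: "bounded_Borel_density K" and B: "\<And>y. K y \<le> B" and th: "\<theta> > 0"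
    and f: "\<And>y. 0 \<le> f y" "\<And>y. f y \<le> C" and [measurable]: "f \<in> borel_measurable borel"
  shows "(LINT y|lborel. f y * (scaled_kernel K \<theta> x y)\<^sup>2) \<le> C * B / \<theta> ^ CARD('r)"
proof -
  let ?k = "scaled_kernel K \<theta> x"
  note int = scaled_kernel_lborel[OF K th, of x]
  have [measurable]: "?k \<in> borel_measurable borel" using int(1) by auto
  have k: "0 \<le> ?k y" "?k y \<le> B / \<theta> ^ CARD('r)" for y
    using scaled_kernel_nonneg[OF K th] scaled_kernel_le[OF B th] by auto
  have C: "0 \<le> C" using f[of 0] by simp
  have le: "f y * (?k y)\<^sup>2 \<le> (C * (B / \<theta> ^ CARD('r))) * ?k y" for y
    unfolding power2_eq_square mult.assoc[symmetric]
    using f[of y] k[of y] C by (intro mult_right_mono mult_mono) auto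
  have "(LINT y|lborel. f y * (?k y)\<^sup>2) \<le> (LINT y|lborel. (C * (B / \<theta> ^ CARD('r))) * ?k y)"
  proof (rule integral_mono_AE')
    have "0 \<le> (C * (B / \<theta> ^ CARD('r))) * ?k y" for y
      using f k by (intro order_trans[OF _ le]) auto
    then show "AE y in lborel. 0 \<le> (C * (B / \<theta> ^ CARD('r))) * ?k y" by (rule AE_I2)
  qed (use int le in auto)
  then show ?thesis using int by simp
qed

text \<open>The average is compared first with \<open>h x\<close> times the kernel mass inside
  \<open>X\<close>: there the Hoelder bound integrates to a multiple of
  \<open>\<theta> powr \<nu>\<close>. The second term accounts for the mass lost outside
  \<open>X\<close>.\<close>

lemma kernel_average_bias_le:
  fixes K h :: "real^'r \<Rightarrow> real"
  assumes K: "bounded_Borel_density K" and X: "X \<in> sets borel" and th: "\<theta> > 0"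
    and mom: "integrable lborel (\<lambda>u. norm u powr \<nu> * K u)"
    and h: "\<And>y. y \<in> X \<Longrightarrow> \<bar>h y\<bar> \<le> C" and hm: "(\<lambda>y. indicator X y * h y) \<in> borel_measurable borel"
    and Hoelder: "\<And>y. y \<in> X \<Longrightarrow> \<bar>h x - h y\<bar> \<le> H * norm (x - y) powr \<nu>"
  shows "\<bar>(LINT y|lborel. indicator X y * h y * scaled_kernel K \<theta> x y) - h x\<bar>
    \<le> \<bar>H\<bar> * (LINT u|lborel. norm u powr \<nu> * K u) * \<theta> powr \<nu>
      + \<bar>h x\<bar> * \<bar>(LINT y:X|lborel. scaled_kernel K \<theta> x y) - 1\<bar>"
proof -
  let ?k = "scaled_kernel K \<theta> x"
  \<comment> \<open>The rescaled moment integrand: since the norm is homogeneous, weighting the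
    kernel by \<open>norm (x - y) powr \<nu>\<close> gives exactly
    \<open>\<theta> powr \<nu> * w y\<close>.\<close>
  define w where "w y = 1 / \<theta> ^ DIM(real^'r) * (norm ((1 / \<theta>) *\<^sub>R (y - x)) powr \<nu> * K ((1 / \<theta>) *\<^sub>R (y - x)))" for y
  have w: "integrable lborel w" "integral\<^sup>L lborel w = (LINT u|lborel. norm u powr \<nu> * K u)"
    using affine_rescaling_lborel[OF mom th, of x] by (simp_all add: w_def[abs_def])
  have w_eq: "norm (x - y) powr \<nu> * ?k y = \<theta> powr \<nu> * w y" for y
    using th by (simp add: w_def scaled_kernel_def powr_divide norm_minus_commute)
  note int = scaled_kernel_lborel[OF K th, of x]
  have [measurable]: "?k \<in> borel_measurable borel" using int(1) by auto
  note [measurable] = X hm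
  have k: "0 \<le> ?k y" for y by (rule scaled_kernel_nonneg[OF K th])
  have i1: "integrable lborel (\<lambda>y. indicator X y * h y * ?k y)"
  proof (rule Bochner_Integration.integrable_bound[of _ "\<lambda>y. C * ?k y"])
    show "AE y in lborel. norm (indicator X y * h y * ?k y) \<le> norm (C * ?k y)"
    proof (rule AE_I2)
      fix y show "norm (indicator X y * h y * ?k y) \<le> norm (C * ?k y)"
        using h[of y] k[of y]
        by (cases "y \<in> X") (auto simp: abs_mult intro!: mult_right_mono)
    qed
  qed (use int in auto)
  have i2: "integrable lborel (\<lambda>y. indicator X y * ?k y)"
    using integrable_mult_indicator[OF _ int(1), of X] by simp
  have "(LINT y|lborel. indicator X y * h y * ?k y) - h x * (LINT y:X|lborel. ?k y)
      = (LINT y|lborel. indicator X y * h y * ?k y - h x * (indicator X y * ?k y))"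
    using i1 i2 by (simp add: set_lebesgue_integral_def)
  also have "\<bar>\<dots>\<bar> \<le> (LINT y|lborel. \<bar>H\<bar> * (\<theta> powr \<nu> * w y))"
  proof -
    \<comment> \<open>\<open>H\<close> comes without a sign; \<open>\<bar>H\<bar>\<close> keeps the
      right side nonnegative off \<open>X\<close>, where the left side is 0.\<close>
    have "norm (indicator X y * h y * ?k y - h x * (indicator X y * ?k y)) \<le> \<bar>H\<bar> * (\<theta> powr \<nu> * w y)" for y
    proof (cases "y \<in> X")
      case True
      then have "norm (indicator X y * h y * ?k y - h x * (indicator X y * ?k y)) = \<bar>h x - h y\<bar> * ?k y"
        using k[of y] by (simp add: abs_mult abs_minus_commute flip: left_diff_distrib)
      also have "\<dots> \<le> (H * norm (x - y) powr \<nu>) * ?k y"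
        by (intro mult_right_mono Hoelder True k)
      also have "\<dots> \<le> (\<bar>H\<bar> * norm (x - y) powr \<nu>) * ?k y"
        by (intro mult_right_mono k) auto
      finally show ?thesis by (simp add: w_eq mult.assoc)
    qed (use k[of y] in \<open>simp flip: w_eq\<close>)
    then show ?thesis
      using w(1) i1 i2 by (intro integral_abs_bound_integral) auto
  qed
  finally have "\<bar>(LINT y|lborel. indicator X y * h y * ?k y) - h x * (LINT y:X|lborel. ?k y)\<bar>
    \<le> \<bar>H\<bar> * (LINT u|lborel. norm u powr \<nu> * K u) * \<theta> powr \<nu>"
    by (simp add: w mult_ac)
  moreover have "\<bar>h x * (LINT y:X|lborel. ?k y) - h x\<bar> = \<bar>h x\<bar> * \<bar>(LINT y:X|lborel. ?k y) - 1\<bar>"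
    by (simp add: right_diff_distrib flip: abs_mult)
  ultimately show ?thesis
    by linarith
qed

section \<open>The mean square error over one step\<close>

text \<open>The unclipped error is \<open>(1 - \<rho>) * (z - c) + \<rho> * (k - c)\<close>, whose
  square gives the first three terms. Only afterwards is the target moved from \<open>c\<close> to
  \<open>c'\<close>, at a cost linear in \<open>\<delta>\<close> since all values lie in
  \<open>[0, C]\<close>.\<close>

lemma clipped_step_error_le:
  fixes z \<rho> k c c' \<delta> lo hi C :: real
  assumes c: "lo \<le> c" "c \<le> hi" and c': "lo \<le> c'" "c' \<le> hi" and C: "0 \<le> lo" "hi \<le> C"
    and d: "\<bar>c' - c\<bar> \<le> \<delta>"
  shows "(min hi (max lo (z - \<rho> * (z - k))) - c')\<^sup>2
    \<le> (1 - \<rho>)\<^sup>2 * (z - c)\<^sup>2 + 2 * \<rho> * (1 - \<rho>) * ((z - c) * (k - c)) + \<rho>\<^sup>2 * (2 * k\<^sup>2 + 2 * C\<^sup>2) + 3 * C * \<delta>"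
proof -
  define v where "v = min hi (max lo (z - \<rho> * (z - k)))"
  have v: "lo \<le> v" "v \<le> hi" using c by (auto simp: v_def)
  have "(v - c)\<^sup>2 \<le> (z - \<rho> * (z - k) - c)\<^sup>2"
    using c by (intro abs_le_square_iff[THEN iffD1]) (auto simp: v_def)
  also have "\<dots> = (1 - \<rho>)\<^sup>2 * (z - c)\<^sup>2 + 2 * \<rho> * (1 - \<rho>) * ((z - c) * (k - c)) + \<rho>\<^sup>2 * (k - c)\<^sup>2"
    by (simp add: power2_eq_square algebra_simps)
  also have "(k - c)\<^sup>2 \<le> 2 * k\<^sup>2 + 2 * C\<^sup>2"
  proof -
    have "c\<^sup>2 \<le> C\<^sup>2" using c C by (intro power_mono) auto
    \<comment> \<open>Parallelogram identity; dropping \<open>(k + c)\<^sup>2\<close> separates the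
      second moment of \<open>k\<close> from a constant.\<close>
    moreover have "(k - c)\<^sup>2 + (k + c)\<^sup>2 = 2 * k\<^sup>2 + 2 * c\<^sup>2"
      by (simp add: power2_eq_square algebra_simps)
    ultimately show ?thesis using zero_le_power2[of "k + c"] by linarith
  qed
  finally have 1: "(v - c)\<^sup>2 \<le> (1 - \<rho>)\<^sup>2 * (z - c)\<^sup>2 + 2 * \<rho> * (1 - \<rho>) * ((z - c) * (k - c)) + \<rho>\<^sup>2 * (2 * k\<^sup>2 + 2 * C\<^sup>2)"
    by (simp add: mult_left_mono)
  have "(v - c')\<^sup>2 - (v - c)\<^sup>2 = (c - c') * ((v - c) + (v - c'))"
    by (simp add: power2_eq_square algebra_simps)
  also have "\<dots> \<le> \<bar>c - c'\<bar> * \<bar>(v - c) + (v - c')\<bar>"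
    by (metis abs_ge_self abs_mult)
  \<comment> \<open>Each of the two differences is at most \<open>C\<close> in absolute value, so
    \<open>3 * C\<close> is a generous bound for their sum.\<close>
  also have "\<dots> \<le> \<delta> * (3 * C)"
    using v c c' C d by (intro mult_mono) auto
  finally show ?thesis using 1 by (simp add: v_def mult_ac)
qed

text \<open>Expectation of the pointwise bound, with \<open>h\<close>, \<open>c\<close>,
  \<open>c'\<close> in the roles of the current density and its present and next values at
  \<open>x\<close>. Writing the drift cost as \<open>\<rho> t\<close> times a bracket produces the
  quotient \<open>\<delta> / \<rho> t\<close>.\<close>

lemma (in prob_space) sqg_mean_square_step:
  fixes K :: "real^'r \<Rightarrow> real" and obs :: "nat \<Rightarrow> 'a \<Rightarrow> real^'r"
  assumes K: "bounded_Borel_density K" "\<And>y. K y \<le> B" and X: "X \<in> sets borel"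
    and ind: "indep_vars (\<lambda>_. borel) obs UNIV"
    and distr: "distributed M lborel (obs t) (\<lambda>y. ennreal (indicator X y * h y))"
    and h: "\<And>y. y \<in> X \<Longrightarrow> 0 \<le> h y" "\<And>y. y \<in> X \<Longrightarrow> h y \<le> C"
      and hm: "(\<lambda>y. indicator X y * h y) \<in> borel_measurable borel"
    and z0: "lo x \<le> z0" "z0 \<le> hi x" and lohi: "0 \<le> lo x" "hi x \<le> C"
    and c: "lo x \<le> c" "c \<le> hi x" and c': "lo x \<le> c'" "c' \<le> hi x" and d: "\<bar>c' - c\<bar> \<le> \<delta>"
    and th: "\<theta> t > 0" and r: "0 < \<rho> t" "\<rho> t \<le> 1"
    and bias: "\<bar>(LINT y|lborel. indicator X y * h y * scaled_kernel K (\<theta> t) x y) - c\<bar> \<le> b"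
  shows "expectation (\<lambda>\<omega>. (sqg_estimate lo hi K \<rho> \<theta> z0 obs x (Suc t) \<omega> - c')\<^sup>2)
    \<le> (1 - \<rho> t) * expectation (\<lambda>\<omega>. (sqg_estimate lo hi K \<rho> \<theta> z0 obs x t \<omega> - c)\<^sup>2)
      + \<rho> t * (2 * C * b + 2 * C * B * (\<rho> t / \<theta> t ^ CARD('r)) + 2 * C\<^sup>2 * \<rho> t + 3 * C * (\<delta> / \<rho> t))"
proof -
  define Z where "Z = sqg_estimate lo hi K \<rho> \<theta> z0 obs x t"
  define k where "k = scaled_kernel K (\<theta> t) x"
  have Km: "K \<in> borel_measurable borel" using K by (simp add: bounded_Borel_density_def)
  have indZ: "indep_var borel Z borel (\<lambda>\<omega>. k (obs t \<omega>))"
    unfolding Z_def k_def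
    by (rule indep_var_sqg_estimate_obs[OF Km ind scaled_kernel_measurable[OF Km]])
  have [measurable]: "Z \<in> borel_measurable M" "obs t \<in> borel_measurable M" "k \<in> borel_measurable borel"
    using indep_var_rv1[OF indZ] ind scaled_kernel_measurable[OF Km]
    by (auto simp: k_def indep_vars_def)
  have C: "0 \<le> C" using lohi c by linarith
  have kb: "0 \<le> k y" "k y \<le> B / \<theta> t ^ CARD('r)" for y
    using scaled_kernel_nonneg[OF K(1) th] scaled_kernel_le[OF K(2) th] by (auto simp: k_def)
  have Zb: "\<bar>Z \<omega> - c\<bar> \<le> C" for \<omega>
    using sqg_estimate_between[of lo x z0 hi K \<rho> \<theta> obs t \<omega>] z0 lohi c by (simp add: Z_def)
  have intZ: "integrable M (\<lambda>\<omega>. Z \<omega> - c)"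
    by (rule integrable_const_bound[of _ C]) (use Zb in auto)
  have intZ2: "integrable M (\<lambda>\<omega>. (Z \<omega> - c)\<^sup>2)"
    by (rule integrable_const_bound[of _ "C\<^sup>2"]) (use Zb C in \<open>auto intro!: AE_I2 simp: abs_le_square_iff[symmetric]\<close>)
  have intk: "integrable M (\<lambda>\<omega>. k (obs t \<omega>))"
    by (rule integrable_const_bound[of _ "B / \<theta> t ^ CARD('r)"]) (use kb in auto)
  have intk2: "integrable M (\<lambda>\<omega>. (k (obs t \<omega>))\<^sup>2)"
    by (rule integrable_const_bound[of _ "(B / \<theta> t ^ CARD('r))\<^sup>2"]) (use kb in \<open>auto intro!: AE_I2 power_mono\<close>)
  have indZk: "indep_var borel (\<lambda>\<omega>. Z \<omega> - c) borel (\<lambda>\<omega>. k (obs t \<omega>) - c)"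
    using indep_var_compose[OF indZ, of "\<lambda>z. z - c" borel "\<lambda>z. z - c" borel] by (simp add: comp_def)
  have intkc: "integrable M (\<lambda>\<omega>. k (obs t \<omega>) - c)" using intk by simp
  note intZk = indep_var_integrable[OF indZk intZ intkc]
  have f0: "0 \<le> indicator X y * h y" "indicator X y * h y \<le> C" for y
    using h[of y] C by (auto simp: indicator_def)
  have Ek: "expectation (\<lambda>\<omega>. k (obs t \<omega>)) = (LINT y|lborel. indicator X y * h y * k y)"
    by (rule distributed_integral[OF distr, symmetric]) (use f0 in auto)
  have Ek2: "expectation (\<lambda>\<omega>. (k (obs t \<omega>))\<^sup>2) \<le> C * B / \<theta> t ^ CARD('r)"
  proof -
    have "expectation (\<lambda>\<omega>. (k (obs t \<omega>))\<^sup>2) = (LINT y|lborel. indicator X y * h y * (k y)\<^sup>2)"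
      by (rule distributed_integral[OF distr, symmetric]) (use f0 in auto)
    also have "\<dots> \<le> C * B / \<theta> t ^ CARD('r)"
      unfolding k_def by (rule scaled_kernel_second_moment_le[OF K th f0 hm])
    finally show ?thesis .
  qed
  have EZk: "expectation (\<lambda>\<omega>. (Z \<omega> - c) * (k (obs t \<omega>) - c)) \<le> C * b"
  proof -
    have "expectation (\<lambda>\<omega>. (Z \<omega> - c) * (k (obs t \<omega>) - c))
        = expectation (\<lambda>\<omega>. Z \<omega> - c) * (expectation (\<lambda>\<omega>. k (obs t \<omega>)) - c)"
      using indep_var_lebesgue_integral[OF indZk intZ intkc] intk by (simp add: prob_space)
    also have "\<dots> \<le> \<bar>expectation (\<lambda>\<omega>. Z \<omega> - c)\<bar> * \<bar>expectation (\<lambda>\<omega>. k (obs t \<omega>)) - c\<bar>"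
      by (metis abs_ge_self abs_mult)
    also have "\<dots> \<le> C * b"
    proof (rule mult_mono)
      have "\<bar>expectation (\<lambda>\<omega>. Z \<omega> - c)\<bar> \<le> expectation (\<lambda>_. C)"
        by (rule order_trans[OF integral_abs_bound integral_mono[OF integrable_abs[OF intZ]]]) (simp_all add: Zb)
      then show "\<bar>expectation (\<lambda>\<omega>. Z \<omega> - c)\<bar> \<le> C" by (simp add: prob_space)
    qed (use bias[folded k_def] C in \<open>auto simp: Ek\<close>)
    finally show ?thesis .
  qed
  let ?R = "\<lambda>\<omega>. (1 - \<rho> t)\<^sup>2 * (Z \<omega> - c)\<^sup>2 + 2 * \<rho> t * (1 - \<rho> t) * ((Z \<omega> - c) * (k (obs t \<omega>) - c))
       + (\<rho> t)\<^sup>2 * (2 * (k (obs t \<omega>))\<^sup>2 + 2 * C\<^sup>2) + 3 * C * \<delta>"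
  have pointwise: "(sqg_estimate lo hi K \<rho> \<theta> z0 obs x (Suc t) \<omega> - c')\<^sup>2 \<le> ?R \<omega>" for \<omega>
    using clipped_step_error_le[OF c c' lohi d, where z = "Z \<omega>" and \<rho> = "\<rho> t" and k = "k (obs t \<omega>)"]
    by (simp add: Z_def k_def sqg_direction_def)
  have "expectation (\<lambda>\<omega>. (sqg_estimate lo hi K \<rho> \<theta> z0 obs x (Suc t) \<omega> - c')\<^sup>2) \<le> expectation ?R"
  proof (rule integral_mono_AE')
    \<comment> \<open>The majorant is nonnegative because it dominates a square.\<close>
    show "AE \<omega> in M. 0 \<le> ?R \<omega>"
      by (rule AE_I2) (rule order_trans[OF zero_le_power2 pointwise])
  qed (use pointwise intZ2 intZk intk2 in auto)
  also have "\<dots> = (1 - \<rho> t)\<^sup>2 * expectation (\<lambda>\<omega>. (Z \<omega> - c)\<^sup>2)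
      + 2 * \<rho> t * (1 - \<rho> t) * expectation (\<lambda>\<omega>. (Z \<omega> - c) * (k (obs t \<omega>) - c))
      + (\<rho> t)\<^sup>2 * (2 * expectation (\<lambda>\<omega>. (k (obs t \<omega>))\<^sup>2) + 2 * C\<^sup>2) + 3 * C * \<delta>"
    using intZ2 intZk intk2 by (simp add: prob_space)
  also have "\<dots> \<le> (1 - \<rho> t) * expectation (\<lambda>\<omega>. (Z \<omega> - c)\<^sup>2) + 2 * \<rho> t * (C * b)
      + (\<rho> t)\<^sup>2 * (2 * (C * B / \<theta> t ^ CARD('r)) + 2 * C\<^sup>2) + 3 * C * \<delta>"
  proof (intro add_mono mult_left_mono Ek2)
    \<comment> \<open>One factor \<open>1 - \<rho> t\<close>, which lies in \<open>[0, 1]\<close>,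
      is given up to reach the form of the averaging recursion.\<close>
    show "(1 - \<rho> t)\<^sup>2 * expectation (\<lambda>\<omega>. (Z \<omega> - c)\<^sup>2) \<le> (1 - \<rho> t) * expectation (\<lambda>\<omega>. (Z \<omega> - c)\<^sup>2)"
      using r by (intro mult_right_mono) (auto simp: power2_eq_square mult_left_le)
    have b: "0 \<le> b" using bias by linarith
    have "2 * \<rho> t * (1 - \<rho> t) * expectation (\<lambda>\<omega>. (Z \<omega> - c) * (k (obs t \<omega>) - c))
      \<le> 2 * \<rho> t * (1 - \<rho> t) * (C * b)"
      using r by (intro mult_left_mono EZk) auto
    also have "\<dots> \<le> 2 * \<rho> t * (C * b)"
      using r b C by (intro mult_right_mono) (auto simp: mult_left_le)
    finally show "2 * \<rho> t * (1 - \<rho> t) * expectation (\<lambda>\<omega>. (Z \<omega> - c) * (k (obs t \<omega>) - c)) \<le> 2 * \<rho> t * (C * b)" .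
  qed (use C in auto)
  also have "\<dots> = (1 - \<rho> t) * expectation (\<lambda>\<omega>. (Z \<omega> - c)\<^sup>2)
      + \<rho> t * (2 * C * b + 2 * C * B * (\<rho> t / \<theta> t ^ CARD('r)) + 2 * C\<^sup>2 * \<rho> t + 3 * C * (\<delta> / \<rho> t))"
    using r by (simp add: field_simps power2_eq_square)
  finally show ?thesis unfolding Z_def .
qed

section \<open>Vanishing of the mean square error\<close>

theorem theorem2:
  fixes M :: "'w measure"
    and X :: "(real^'r) set"
    and lo hi :: "real^'r \<Rightarrow> real" and gmax :: real
    and g :: "nat \<Rightarrow> real^'r \<Rightarrow> real"
    and obs :: "nat \<Rightarrow> 'w \<Rightarrow> real^'r"
    and K :: "real^'r \<Rightarrow> real" and Kmax :: real
    and x :: "real^'r" and H \<nu> z0 :: real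
    and \<delta> \<rho> \<theta> :: "nat \<Rightarrow> real"
  assumes "prob_space M"
    and "X \<in> sets borel" and "x \<in> X"
    and "\<And>t. density_on X (g t)"
    and "prob_space.indep_vars M (\<lambda>_. borel) obs UNIV"
    and "\<And>t. distributed M lborel (obs t) (\<lambda>y. ennreal (indicator X y * g t y))"
    and "\<And>t. g t \<in> class_G X lo hi gmax"
    and "\<And>t. \<bar>g (Suc t) x - g t x\<bar> \<le> \<delta> t" and "\<delta> \<longlonglongrightarrow> 0"
    and "bounded_Borel_density K"
    and "(LINT y:X|lborel. K y) = 1" and "\<And>y. y \<in> X \<Longrightarrow> K y \<le> Kmax"
    and "(\<integral>\<^sup>+ y. ennreal (norm y powr \<nu> * K y) \<partial>lborel) < \<infinity>"
    and "\<And>t. \<rho> t > 0" and "\<And>t. \<theta> t > 0"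
    and "\<rho> \<longlonglongrightarrow> 0" and "\<theta> \<longlonglongrightarrow> 0"
    and "(\<lambda>t. \<delta> t / \<rho> t) \<longlonglongrightarrow> 0"
    and "(\<lambda>t. \<rho> t / \<theta> t ^ CARD('r)) \<longlonglongrightarrow> 0"
    and "filterlim (\<lambda>n. \<Sum>t<n. \<rho> t) at_top sequentially"
    and "window_mass_in X K \<theta> x"
    and "lo x \<le> z0" and "z0 \<le> hi x"
    and "globally_Hoelder_at X g x H \<nu>"
  shows "(\<lambda>t. prob_space.expectation M
            (\<lambda>\<omega>. (sqg_estimate lo hi K \<rho> \<theta> z0 obs x t \<omega> - g t x)\<^sup>2)) \<longlonglongrightarrow> 0"
proof -
  interpret prob_space M by fact
  note [measurable] = \<open>X \<in> sets borel\<close>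
  note K = \<open>bounded_Borel_density K\<close>
  have Km [measurable]: "K \<in> borel_measurable borel" and K0: "0 \<le> K y" for y
    using K by (auto simp: bounded_Borel_density_def)
  \<comment> \<open>The scaled kernel evaluates \<open>K\<close> at
    \<open>(y - x) / \<theta> t\<close>, which may leave \<open>X\<close>, so the bound is taken
    over the whole space.\<close>
  obtain B where B: "K y \<le> B" for y
    using K unfolding bounded_Borel_density_def bounded_iff by (auto simp: abs_le_iff)
  have G: "0 \<le> lo y" "lo y \<le> g t y" "g t y \<le> hi y" "hi y \<le> gmax" if "y \<in> X" for t y
    using \<open>\<And>t. g t \<in> class_G X lo hi gmax\<close> that by (auto simp: class_G_def)
  note Gx = G[OF \<open>x \<in> X\<close>]
  have gm: "(\<lambda>y. indicator X y * g t y) \<in> borel_measurable borel" for t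
    using \<open>density_on X (g t)\<close> by (simp add: density_on_def set_borel_measurable_def)
  have Hoelder: "\<nu> > 0" "\<And>t y. y \<in> X \<Longrightarrow> \<bar>g t x - g t y\<bar> \<le> H * norm (x - y) powr \<nu>"
    using \<open>globally_Hoelder_at X g x H \<nu>\<close> by (auto simp: globally_Hoelder_at_def)
  have mom: "integrable lborel (\<lambda>u. norm u powr \<nu> * K u)"
    using \<open>(\<integral>\<^sup>+ y. ennreal (norm y powr \<nu> * K y) \<partial>lborel) < \<infinity>\<close> K0
    by (intro integrableI_nonneg) auto
  \<comment> \<open>The constant \<open>gmax\<close> replaces \<open>g t x\<close>, which varies
    with \<open>t\<close>; then the first term vanishes with \<open>\<theta>\<close> and the second
    by \<open>window_mass_in\<close>.\<close>
  define b where "b t = \<bar>H\<bar> * (LINT u|lborel. norm u powr \<nu> * K u) * \<theta> t powr \<nu>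
      + gmax * \<bar>(LINT y:X|lborel. scaled_kernel K (\<theta> t) x y) - 1\<bar>" for t
  have b: "\<bar>(LINT y|lborel. indicator X y * g t y * scaled_kernel K (\<theta> t) x y) - g t x\<bar> \<le> b t" for t
  proof -
    have "\<bar>g t y\<bar> \<le> gmax" if "y \<in> X" for y
      using G(1,4)[OF that] G(2,3)[OF that, of t] by linarith
    note kernel_average_bias_le[OF K \<open>X \<in> sets borel\<close> \<open>\<theta> t > 0\<close> mom this gm Hoelder(2)]
    also have "\<bar>H\<bar> * (LINT u|lborel. norm u powr \<nu> * K u) * \<theta> t powr \<nu>
      + \<bar>g t x\<bar> * \<bar>(LINT y:X|lborel. scaled_kernel K (\<theta> t) x y) - 1\<bar> \<le> b t"
      unfolding b_def using Gx(1,4) Gx(2,3)[of t] by (intro add_left_mono mult_right_mono) auto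
    finally show ?thesis .
  qed
  have b0: "b \<longlonglongrightarrow> 0"
  proof -
    have 1: "(\<lambda>t. \<theta> t powr \<nu>) \<longlonglongrightarrow> 0"
      using \<open>\<theta> \<longlonglongrightarrow> 0\<close> \<open>\<And>t. \<theta> t > 0\<close> Hoelder(1)
      by (intro tendsto_zero_powrI) (auto intro!: always_eventually less_imp_le)
    have 2: "(\<lambda>t. \<bar>(LINT y:X|lborel. scaled_kernel K (\<theta> t) x y) - 1\<bar>) \<longlonglongrightarrow> 0"
      using \<open>window_mass_in X K \<theta> x\<close> unfolding window_mass_in_def
      by (intro tendsto_rabs_zero LIM_zero)
    show ?thesis
      unfolding b_def[abs_def] by (rule tendsto_add_zero tendsto_mult_right_zero 1 2)+
  qed
  \<comment> \<open>The bracket of \<open>sqg_mean_square_step\<close> for \<open>C = gmax\<close>;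
    each summand is a constant times a null sequence.\<close>
  define \<epsilon> where "\<epsilon> t = 2 * gmax * b t + 2 * gmax * B * (\<rho> t / \<theta> t ^ CARD('r))
    + 2 * gmax\<^sup>2 * \<rho> t + 3 * gmax * (\<delta> t / \<rho> t)" for t
  have eps0: "\<epsilon> \<longlonglongrightarrow> 0"
    unfolding \<epsilon>_def[abs_def]
    by (intro tendsto_add_zero tendsto_mult_right_zero b0 \<open>\<rho> \<longlonglongrightarrow> 0\<close>
        \<open>(\<lambda>t. \<delta> t / \<rho> t) \<longlonglongrightarrow> 0\<close> \<open>(\<lambda>t. \<rho> t / \<theta> t ^ CARD('r)) \<longlonglongrightarrow> 0\<close>)
  \<comment> \<open>The one-step inequality requires \<open>\<rho> t \<le> 1\<close>, which holds
    only from some time on; the averaging recursion is stated eventually for this reason.\<close>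
  have "\<forall>\<^sub>F t in sequentially. \<rho> t < 1"
    using \<open>\<rho> \<longlonglongrightarrow> 0\<close> by (rule order_tendstoD(2)) simp
  then have step: "\<forall>\<^sub>F t in sequentially. \<rho> t \<le> 1 \<and>
      expectation (\<lambda>\<omega>. (sqg_estimate lo hi K \<rho> \<theta> z0 obs x (Suc t) \<omega> - g (Suc t) x)\<^sup>2)
      \<le> (1 - \<rho> t) * expectation (\<lambda>\<omega>. (sqg_estimate lo hi K \<rho> \<theta> z0 obs x t \<omega> - g t x)\<^sup>2) + \<rho> t * \<epsilon> t"
  proof eventually_elim
    case (elim t)
    have g: "0 \<le> g t y" "g t y \<le> gmax" if "y \<in> X" for y
      using G(1,4)[OF that] G(2,3)[OF that, of t] by auto
    show ?case
      unfolding \<epsilon>_def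
      using sqg_mean_square_step[where \<theta> = \<theta> and \<rho> = \<rho> and t = t and h = "g t" and lo = lo and hi = hi
            and x = x and c = "g t x" and c' = "g (Suc t) x" and \<delta> = "\<delta> t" and b = "b t",
          OF K B \<open>X \<in> sets borel\<close>
          \<open>indep_vars (\<lambda>_. borel) obs UNIV\<close>
          \<open>distributed M lborel (obs t) (\<lambda>y. ennreal (indicator X y * g t y))\<close>
          g gm \<open>lo x \<le> z0\<close> \<open>z0 \<le> hi x\<close> Gx(1) Gx(4) Gx(2,3)[of t] Gx(2,3)[of "Suc t"]
          \<open>\<bar>g (Suc t) x - g t x\<bar> \<le> \<delta> t\<close> \<open>\<theta> t > 0\<close> \<open>\<rho> t > 0\<close> less_imp_le[OF elim] b]
        elim by simp
  qed
  show ?thesis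
    by (rule averaging_recursion_tendsto_0[OF _ _ step eps0])
      (use \<open>\<And>t. \<rho> t > 0\<close> \<open>filterlim (\<lambda>n. \<Sum>t<n. \<rho> t) at_top sequentially\<close>
        in \<open>auto intro: less_imp_le\<close>)
qed

end
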